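(* Let $\mathfrak{m}$ be a convex polyhedron in $\mathbb{R}^3$ with vertex set $\{\mathbf{v}_i\}$ and an associated set of generalized barycentric coordinates $\{\lambda_i\}$, and let $$\mathcal{W}_{ijk}:=\lambda_i\nabla\lambda_j\times\nabla\lambda_k+\lambda_j\nabla\lambda_k\times\nabla\lambda_i+\lambda_k\nabla\lambda_i\times\nabla\lambda_j.$$ Then $$\sum_{i<j<k}\mathcal{W}_{ijk}\bigl((\mathbf{v}_j-\mathbf{v}_i)\times(\mathbf{v}_k-\mathbf{v}_i)\bigr)^T=\mathbb{I},$$ where $\mathbb{I}$ is the $3\times3$ identity matrix, and $$\sum_{i<j<k}\bigl(\mathbf{v}_i\cdot(\mathbf{v}_j\times\mathbf{v}_k)\bigr)\mathcal{W}_{ijk}=\mathbf{x}.$$ Thus, $\operatorname{span}\{\mathcal{W}_{ijk} : \mathbf{v}_i,\mathbf{v}_j,\mathbf{v}_k\in\mathfrak{m}\}\supseteq\mathcal{P}_1^-\Lambda^2(\mathfrak{m})$.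
   Context: Generalized barycentric coordinates on $\mathfrak{m}$: non-negative functions $\lambda_i:\mathfrak{m}\to\mathbb{R}$, one for each vertex $\mathbf{v}_i$, such that every linear function $L$ (polynomial of degree at most 1) satisfies $L=\sum_i L(\mathbf{v}_i)\lambda_i$ on $\mathfrak{m}$. The vertices are indexed by an ordered finite set, and $\sum_{i<j<k}$ runs over triples of vertex indices with $i<j<k$. Vectors (vertices, gradients, cross products, and the position $\mathbf{x}=(x_1,x_2,x_3)^T$) are column vectors; $\mathbf{v}_i\in\mathfrak{m}$ in the span refers to vertices of $\mathfrak{m}$. The $\lambda_i$ are assumed differentiable wherever gradients are written: the identities and the span inclusion are understood as statements about functions of $\mathbf{x}$ on the set of points of $\mathfrak{m}$ at which all $\lambda_i$ are differentiable relative to $\mathfrak{m}$ (i.e. $\lambda_i(\mathbf{y})=\lambda_i(\mathbf{x})+\nabla\lambda_i(\mathbf{x})\cdot(\mathbf{y}-\mathbf{x})+o(|\mathbf{y}-\mathbf{x}|)$ for $\mathbf{y}\in\mathfrak{m}$). $\mathcal{P}_1^-\Lambda^2:=\mathcal{P}_0\Lambda^2\oplus\kappa\mathcal{H}_0\Lambda^3$, where $\mathcal{P}_0\Lambda^2$ is the space of 2-forms with constant coefficients, $\mathcal{H}_0\Lambda^3$ is spanned by $dx_1\wedge dx_2\wedge dx_3$, and the Koszul operator gives $\kappa(dx_1\wedge dx_2\wedge dx_3)=x_1dx_2\wedge dx_3-x_2dx_1\wedge dx_3+x_3dx_1\wedge dx_2$. 2-forms are identified with vector fields by $w_1dx_2dx_3+w_2dx_3dx_1+w_3dx_1dx_2\leftrightarrow(w_1,w_2,w_3)^T$;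 thus $\mathcal{P}_1^-\Lambda^2(\mathfrak{m})$ corresponds to $\{\mathbf{c}+s\mathbf{x}:\mathbf{c}\in\mathbb{R}^3,s\in\mathbb{R}\}$. Span means finite real linear combinations. *)

theory Defs
  imports "HOL-Analysis.Analysis" "HOL-Library.Function_Algebras"
begin

unbundle cross3_syntax

definition degree_le_1 :: "(real^3 \<Rightarrow> real) \<Rightarrow> bool" where
  "degree_le_1 L \<longleftrightarrow> (\<exists>a c. \<forall>x. L x = c + a \<bullet> x)"

definition generalized_barycentric_coordinates ::
  "(real^3) set \<Rightarrow> 'i set \<Rightarrow> ('i \<Rightarrow> real^3) \<Rightarrow> ('i \<Rightarrow> real^3 \<Rightarrow> real) \<Rightarrow> bool" where
  "generalized_barycentric_coordinates m I v lam \<longleftrightarrow>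
     (\<forall>i\<in>I. \<forall>x\<in>m. 0 \<le> lam i x) \<and>
     (\<forall>L. degree_le_1 L \<longrightarrow> (\<forall>x\<in>m. L x = (\<Sum>i\<in>I. L (v i) * lam i x)))"

text \<open>The gradient relative to \<open>m\<close>. It is unique when \<open>m\<close> is convex with nonempty
  interior, also at boundary points of \<open>m\<close>; elsewhere the value is arbitrary.\<close>

definition grad :: "(real^3) set \<Rightarrow> (real^3 \<Rightarrow> real) \<Rightarrow> real^3 \<Rightarrow> real^3" where
  "grad m f x = (THE g. (f has_derivative (\<lambda>h. g \<bullet> h)) (at x within m))"

definition diff_points :: "(real^3) set \<Rightarrow> 'i set \<Rightarrow> ('i \<Rightarrow> real^3 \<Rightarrow> real) \<Rightarrow> (real^3) set" where
  "diff_points m I lam = {x \<in> m. \<forall>i\<in>I. lam i differentiable (at x within m)}"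

definition whitney ::
  "(real^3) set \<Rightarrow> ('i \<Rightarrow> real^3 \<Rightarrow> real) \<Rightarrow> 'i \<Rightarrow> 'i \<Rightarrow> 'i \<Rightarrow> real^3 \<Rightarrow> real^3" where
  "whitney m lam i j k x =
     lam i x *\<^sub>R (grad m (lam j) x \<times> grad m (lam k) x) +
     lam j x *\<^sub>R (grad m (lam k) x \<times> grad m (lam i) x) +
     lam k x *\<^sub>R (grad m (lam i) x \<times> grad m (lam j) x)"

definition increasing_triples :: "'i::linorder set \<Rightarrow> ('i \<times> 'i \<times> 'i) set" where
  "increasing_triples I = {(i, j, k). i \<in> I \<and> j \<in> I \<and> k \<in> I \<and> i < j \<and> j < k}"

definition outer :: "real^3 \<Rightarrow> real^3 \<Rightarrow> real^3^3" where
  "outer a b = (columnvector a :: real^1^3) ** transpose (columnvector b :: real^1^3)"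

lemma outer_nth: "outer a b $ i $ j = a $ i * b $ j"
  by (simp add: outer_def columnvector_def transpose_def matrix_matrix_mult_def)

text \<open>A differential form is a function of the base point followed by the tangent vectors.
  \<open>koszul\<close> is contraction with the position vector field; \<open>koszul_volume\<close> gives
  its value on the volume form in coordinates.\<close>

type_synonym form2 = "real^3 \<Rightarrow> real^3 \<Rightarrow> real^3 \<Rightarrow> real"
type_synonym form3 = "real^3 \<Rightarrow> real^3 \<Rightarrow> real^3 \<Rightarrow> real^3 \<Rightarrow> real"

definition dx_wedge :: "3 \<Rightarrow> 3 \<Rightarrow> real^3 \<Rightarrow> real^3 \<Rightarrow> real" where
  "dx_wedge i j u w = u $ i * w $ j - u $ j * w $ i"

definition volume_form :: form3 where
  "volume_form x u v w = det (vector [u, v, w] :: real^3^3)"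

definition koszul :: "form3 \<Rightarrow> form2" where
  "koszul \<eta> x u w = \<eta> x x u w"

lemma koszul_volume:
  "koszul volume_form x u w = x $ 1 * dx_wedge 2 3 u w - x $ 2 * dx_wedge 1 3 u w + x $ 3 * dx_wedge 1 2 u w"
  by (simp add: koszul_def volume_form_def dx_wedge_def det_3 algebra_simps)

definition P0_Lambda2 :: "form2 set" where
  "P0_Lambda2 = {\<lambda>_. B | B. bilinear B \<and> (\<forall>u. B u u = 0)}"

definition H0_Lambda3 :: "form3 set" where
  "H0_Lambda3 = {\<lambda>x u v w. s * volume_form x u v w | s. True}"

definition P1minus_Lambda2 :: "form2 set" where
  "P1minus_Lambda2 = {\<omega> + koszul \<eta> | \<omega> \<eta>. \<omega> \<in> P0_Lambda2 \<and> \<eta> \<in> H0_Lambda3}"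

lemma P1minus_sum_direct: "P0_Lambda2 \<inter> koszul ` H0_Lambda3 = {0}"
proof (intro equalityI subsetI)
  fix \<omega> assume "\<omega> \<in> P0_Lambda2 \<inter> koszul ` H0_Lambda3"
  then obtain B s where B: "\<omega> = (\<lambda>_. B)"
    and s: "\<omega> = koszul (\<lambda>x u v w. s * volume_form x u v w)"
    unfolding P0_Lambda2_def H0_Lambda3_def by blast
  have "\<omega> x u w = \<omega> 0 u w" for x u w by (simp add: B)
  moreover have "\<omega> 0 u w = 0" for u w
    by (simp add: s koszul_def volume_form_def det_3)
  ultimately show "\<omega> \<in> {0}" by (simp add: fun_eq_iff)
next
  fix \<omega> :: form2 assume "\<omega> \<in> {0}"
  then have w: "\<omega> = 0" by simp
  have "bilinear (0 :: real^3 \<Rightarrow> real^3 \<Rightarrow> real)" by (simp add: bilinear_def linear_iff)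
  then have "\<omega> \<in> P0_Lambda2" unfolding w P0_Lambda2_def by (auto simp: fun_eq_iff intro!: exI[of _ 0])
  moreover have "(\<lambda>x u v w. 0 * volume_form x u v w) \<in> H0_Lambda3"
    unfolding H0_Lambda3_def by blast
  then have "koszul (\<lambda>x u v w. 0 * volume_form x u v w) \<in> koszul ` H0_Lambda3" by (rule imageI)
  then have "\<omega> \<in> koszul ` H0_Lambda3"
    by (simp add: w koszul_def[abs_def] zero_fun_def)
  ultimately show "\<omega> \<in> P0_Lambda2 \<inter> koszul ` H0_Lambda3" by blast
qed

definition form_of_field :: "(real^3 \<Rightarrow> real^3) \<Rightarrow> form2" where
  "form_of_field F x u w =
     F x $ 1 * dx_wedge 2 3 u w + F x $ 2 * dx_wedge 3 1 u w + F x $ 3 * dx_wedge 1 2 u w"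

definition P1minus_fields :: "(real^3 \<Rightarrow> real^3) set" where
  "P1minus_fields = {F. form_of_field F \<in> P1minus_Lambda2}"

lemma form_of_field_cross: "form_of_field F x u w = F x \<bullet> (u \<times> w)"
  by (simp add: form_of_field_def dx_wedge_def inner_vec_def sum_3 cross3_def algebra_simps)

lemma form_of_field_inject: "form_of_field F = form_of_field G \<longleftrightarrow> F = G"
proof
  assume eq: "form_of_field F = form_of_field G"
  have "F x $ i = G x $ i" for x i
  proof -
    have a: "F x \<bullet> (u \<times> w) = G x \<bullet> (u \<times> w)" for u w
      using eq by (metis form_of_field_cross)
    show ?thesis
      using a[of "axis 2 1" "axis 3 1"] a[of "axis 3 1" "axis 1 1"] a[of "axis 1 1" "axis 2 1"]
        exhaust_3[of i]
      by (auto simp: inner_vec_def sum_3 cross3_def axis_def)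
  qed
  then show "F = G" by (auto simp: vec_eq_iff)
qed simp

lemma P0_Lambda2_iff: "P0_Lambda2 = {form_of_field (\<lambda>_. c) | c. True}"
proof (intro equalityI subsetI)
  fix \<omega> assume "\<omega> \<in> P0_Lambda2"
  then obtain B where w: "\<omega> = (\<lambda>_. B)" and bil: "bilinear B" and alt: "\<And>u. B u u = 0"
    unfolding P0_Lambda2_def by auto
  have "B (u + w) (u + w) = B u u + B u w + (B w u + B w w)" for u w
    by (simp add: bilinear_ladd[OF bil] bilinear_radd[OF bil])
  then have anti: "B w u = - B u w" for u w
    using alt by (metis add.left_neutral add.right_neutral add_eq_0_iff)
  define e :: "3 \<Rightarrow> real^3" where "e i = axis i 1" for i
  have ex: "u = u$1 *\<^sub>R e 1 + u$2 *\<^sub>R e 2 + u$3 *\<^sub>R e 3" for u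
    by (simp add: vec_eq_iff forall_3 e_def axis_def)
  define c :: "real^3" where "c = vector [B (e 2) (e 3), B (e 3) (e 1), B (e 1) (e 2)]"
  have "B u w = form_of_field (\<lambda>_. c) x u w" for x u w
  proof -
    have "B u w = B (u$1 *\<^sub>R e 1 + u$2 *\<^sub>R e 2 + u$3 *\<^sub>R e 3)
                    (w$1 *\<^sub>R e 1 + w$2 *\<^sub>R e 2 + w$3 *\<^sub>R e 3)"
      using ex by metis
    also have "\<dots> = form_of_field (\<lambda>_. c) x u w"
      unfolding form_of_field_def dx_wedge_def c_def
      by (simp add: bilinear_ladd[OF bil] bilinear_radd[OF bil] bilinear_lmul[OF bil]
          bilinear_rmul[OF bil] alt anti[of "e 2" "e 1"] anti[of "e 3" "e 2"]
          anti[of "e 1" "e 3"] algebra_simps)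
    finally show ?thesis .
  qed
  then show "\<omega> \<in> {form_of_field (\<lambda>_. c) | c. True}" unfolding w by blast
next
  fix \<omega> assume "\<omega> \<in> {form_of_field (\<lambda>_. c) | c. True}"
  then obtain c where w: "\<omega> = form_of_field (\<lambda>_. c)" by auto
  have "\<omega> = (\<lambda>_ u w. c \<bullet> (u \<times> w))"
    by (simp add: w fun_eq_iff form_of_field_cross)
  moreover have "bilinear (\<lambda>u w. c \<bullet> (u \<times> w))"
    by (auto simp: bilinear_def linear_iff cross_add_left cross_add_right cross_mult_left
        cross_mult_right inner_add_right)
  ultimately show "\<omega> \<in> P0_Lambda2" unfolding P0_Lambda2_def by fastforce
qed

lemma P1minus_fields_iff: "P1minus_fields = {\<lambda>x. c + s *\<^sub>R x | c s. True}"
proof -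
  have k: "form_of_field (\<lambda>_. c) + koszul (\<lambda>x u v w. s * volume_form x u v w) =
      form_of_field (\<lambda>x. c + s *\<^sub>R x)" for c s
    by (simp add: fun_eq_iff form_of_field_def koszul_def volume_form_def dx_wedge_def det_3
        algebra_simps)
  have "P1minus_Lambda2 = {form_of_field (\<lambda>x. c + s *\<^sub>R x) | c s. True}"
    unfolding P1minus_Lambda2_def P0_Lambda2_iff H0_Lambda3_def k[symmetric] by blast
  then have "F \<in> P1minus_fields \<longleftrightarrow> (\<exists>c s. form_of_field F = form_of_field (\<lambda>x. c + s *\<^sub>R x))" for F
    unfolding P1minus_fields_def by blast
  then show ?thesis
    unfolding form_of_field_inject by blast
qed

text \<open>Vector fields on \<open>D\<close> are represented by their extension by zero, so that equality
  of the extensions is equality on \<open>D\<close>.\<close>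

definition on_points :: "(real^3) set \<Rightarrow> (real^3 \<Rightarrow> real^3) \<Rightarrow> (real^3 \<Rightarrow> real^3)" where
  "on_points D F = (\<lambda>x. if x \<in> D then F x else 0)"

definition scale_field :: "real \<Rightarrow> (real^3 \<Rightarrow> real^3) \<Rightarrow> (real^3 \<Rightarrow> real^3)" where
  "scale_field r F = (\<lambda>x. r *\<^sub>R F x)"

interpretation fields: vector_space scale_field
  by standard (simp_all add: scale_field_def fun_eq_iff algebra_simps)

end

theory Submission
  imports Defs
begin

text \<open>
  At a common point of differentiability, differentiating \<open>L = (\<Sum>i. L(v i) \<lambda> i)\<close> gives
  \<open>\<Sum>i. \<nabla>\<lambda> i = 0\<close> and \<open>\<Sum>i. \<nabla>\<lambda> i (v i)\<^sup>T = 1\<close>. Taking second compound matrices,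
  \<open>\<Sum>j k. (\<nabla>\<lambda> j \<times> \<nabla>\<lambda> k) ((v j - w) \<times> (v k - w))\<^sup>T\<close> is twice the identity for every \<open>w\<close>.
  Both the Whitney field \<open>W i j k\<close> and its scalar weights are alternating in the indices, so six
  times the sum over increasing triples is the sum over all triples, in which the three terms
  of \<open>W i j k\<close> contribute equally. What remains is the average over \<open>i\<close>, with weights
  \<open>\<lambda> i\<close>, of the compound identity with \<open>w = v i\<close> or \<open>w = 0\<close>.
\<close>

section \<open>Alternating sums over triples of indices\<close>

text \<open>The rotation and the transposition generate all permutations of three indices, so
  \<open>f\<close> is constant on the six orderings of a triple. It will be a product of two
  alternating factors.\<close>

lemma sum_increasing_triples:
  fixes f :: "'i::linorder \<Rightarrow> 'i \<Rightarrow> 'i \<Rightarrow> 'a::real_vector"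
  assumes fin: "finite I"
    and rot: "\<And>i j k. f j k i = f i j k"
    and swap: "\<And>i j k. f j i k = f i j k"
    and diag: "\<And>i k. f i i k = 0"
  shows "(\<Sum>i\<in>I. \<Sum>j\<in>I. \<Sum>k\<in>I. f i j k) =
    6 *\<^sub>R (\<Sum>(i, j, k)\<in>increasing_triples I. f i j k)"
proof -
  \<comment> \<open>Cutting \<open>f\<close> off by zero keeps every sum over the full cube of
    \<open>I\<close>, where reindexing only exchanges adjacent sums.\<close>
  define h where "h i j k = (if i < j \<and> j < k then f i j k else 0)" for i j k
  let ?S = "\<lambda>h. \<Sum>i\<in>I. \<Sum>j\<in>I. \<Sum>k\<in>I. h i j k"
  have perm: "f i j k = f j k i" "f i j k = f k i j" "f i j k = f j i k"
    "f i j k = f i k j" "f i j k = f k j i" for i j k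
    using rot swap by metis+
  have diags: "f i i k = 0" "f i k i = 0" "f k i i = 0" for i k
    using diag rot by metis+
  \<comment> \<open>For distinct indices exactly one of the six terms survives, the sorted one; for
    a repeated index none does.\<close>
  have split: "f i j k = h i j k + h i k j + h j i k + h j k i + h k i j + h k j i" for i j k
  proof (cases "i = j \<or> j = k \<or> i = k")
    case True
    then have "f i j k = 0" by (auto simp: diags)
    moreover have "h a b c = 0" if "f a b c = 0" for a b c
      using that by (simp add: h_def)
    ultimately show ?thesis by (simp add: perm[of i j k, symmetric])
  next
    case False
    then have neg: "j < i \<longleftrightarrow> \<not> i < j" "k < j \<longleftrightarrow> \<not> j < k" "k < i \<longleftrightarrow> \<not> i < k"
      by auto
    \<comment> \<open>These two implications exclude the cyclic outcomes among the eight
      combinations of comparisons.\<close>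
    have "i < j \<and> j < k \<longrightarrow> i < k" "k < j \<and> j < i \<longrightarrow> k < i"
      by auto
    then show ?thesis
      unfolding neg
      by (cases "i < j"; cases "j < k"; cases "i < k")
        (simp_all add: h_def neg perm[of i j k, symmetric])
  qed
  have s12: "?S (\<lambda>i j k. q j i k) = ?S q" for q :: "'i \<Rightarrow> 'i \<Rightarrow> 'i \<Rightarrow> 'a"
    by (rule sum.swap)
  have s23: "?S (\<lambda>i j k. q i k j) = ?S q" for q :: "'i \<Rightarrow> 'i \<Rightarrow> 'i \<Rightarrow> 'a"
    by (rule sum.cong[OF refl], rule sum.swap)
  have "?S f = ?S h + ?S (\<lambda>i j k. h i k j) + ?S (\<lambda>i j k. h j i k) + ?S (\<lambda>i j k. h j k i)
      + ?S (\<lambda>i j k. h k i j) + ?S (\<lambda>i j k. h k j i)"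
    by (subst split) (simp only: sum.distrib)
  also have "?S (\<lambda>i j k. h i k j) = ?S h" by (rule s23)
  also have "?S (\<lambda>i j k. h j i k) = ?S h" by (rule s12)
  also have "?S (\<lambda>i j k. h j k i) = ?S h"
    using s12[of "\<lambda>i j k. h i k j"] s23[of h] by simp
  also have "?S (\<lambda>i j k. h k i j) = ?S h"
    using s23[of "\<lambda>i j k. h j i k"] s12[of h] by simp
  also have "?S (\<lambda>i j k. h k j i) = ?S h"
    using s12[of "\<lambda>i j k. h k i j"] s23[of "\<lambda>i j k. h j i k"] s12[of h] by simp
  also have "?S h + ?S h + ?S h + ?S h + ?S h + ?S h = (1 + 1 + 1 + 1 + 1 + 1 :: real) *\<^sub>R ?S h"
    by (simp only: scaleR_left_distrib scaleR_one)
  also have "(1 + 1 + 1 + 1 + 1 + 1 :: real) = 6"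
    by simp
  also have "?S h = (\<Sum>(i, j, k)\<in>Sigma I (\<lambda>_. Sigma I (\<lambda>_. I)). h i j k)"
    by (simp add: sum.cartesian_product)
  also have "\<dots> = (\<Sum>(i, j, k)\<in>increasing_triples I. h i j k)"
    by (rule sum.mono_neutral_right)
      (use fin in \<open>auto simp: increasing_triples_def h_def split: if_splits\<close>)
  also have "\<dots> = (\<Sum>(i, j, k)\<in>increasing_triples I. f i j k)"
    by (rule sum.cong) (auto simp: increasing_triples_def h_def)
  finally show ?thesis .
qed

text \<open>The factor is 6/3: six orderings of each triple against three terms of the Whitney field
  with equal total. The sum over \<open>j\<close> is innermost on the right so that linearity in the
  first cross factor applies next.\<close>

lemma sum_increasing_triples_whitney:
  fixes n :: "'i::linorder \<Rightarrow> 'i \<Rightarrow> 'i \<Rightarrow> real"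
  assumes fin: "finite I"
    and rot: "\<And>i j k. n j k i = n i j k"
    and anti: "\<And>i j k. n j i k = - n i j k"
  shows "2 *\<^sub>R (\<Sum>(i, j, k)\<in>increasing_triples I. n i j k *\<^sub>R whitney m lam i j k x) =
    (\<Sum>i\<in>I. lam i x *\<^sub>R (\<Sum>k\<in>I. \<Sum>j\<in>I. n i j k *\<^sub>R (grad m (lam j) x \<times> grad m (lam k) x)))"
proof -
  let ?W = "\<lambda>i j k. whitney m lam i j k x"
  let ?t = "\<lambda>i j k. (n i j k * lam i x) *\<^sub>R (grad m (lam j) x \<times> grad m (lam k) x)"
  let ?S = "\<lambda>h. \<Sum>i\<in>I. \<Sum>j\<in>I. \<Sum>k\<in>I. h i j k"
  have Wrot: "?W j k i = ?W i j k" for i j k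
    by (simp add: whitney_def)
  have Wanti: "?W j i k = - ?W i j k" for i j k
    unfolding whitney_def
    by (subst (1 2 3) cross_skew) simp
  have Wdiag: "?W i i k = 0" for i k
    using cross_skew[of "grad m (lam k) x" "grad m (lam i) x"] by (simp add: whitney_def)
  have s12: "?S (\<lambda>i j k. q j i k) = ?S q" for q :: "'i \<Rightarrow> 'i \<Rightarrow> 'i \<Rightarrow> real^3"
    by (rule sum.swap)
  have s23: "?S (\<lambda>i j k. q i k j) = ?S q" for q :: "'i \<Rightarrow> 'i \<Rightarrow> 'i \<Rightarrow> real^3"
    by (rule sum.cong[OF refl], rule sum.swap)
  \<comment> \<open>Rotation invariance of \<open>n\<close> makes the three terms cyclic shifts of a
    single expression.\<close>
  have t: "n i j k *\<^sub>R ?W i j k = ?t i j k + ?t j k i + ?t k i j" for i j k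
    using rot[of i j k] rot[of j k i]
    by (simp add: whitney_def scaleR_add_right)
  have "6 *\<^sub>R (\<Sum>(i, j, k)\<in>increasing_triples I. n i j k *\<^sub>R ?W i j k) =
      ?S (\<lambda>i j k. n i j k *\<^sub>R ?W i j k)"
  proof (rule sum_increasing_triples[OF fin, symmetric])
    fix i j k
    show "n j k i *\<^sub>R ?W j k i = n i j k *\<^sub>R ?W i j k"
      by (simp only: rot[of j k i] Wrot[of j k i])
    show "n j i k *\<^sub>R ?W j i k = n i j k *\<^sub>R ?W i j k"
      by (simp only: anti[of i j k] Wanti[of i j k] scaleR_minus_left scaleR_minus_right minus_minus)
    show "n i i k *\<^sub>R ?W i i k = 0"
      by (simp only: Wdiag scaleR_zero_right)
  qed
  also have "\<dots> = ?S ?t + ?S (\<lambda>i j k. ?t j k i) + ?S (\<lambda>i j k. ?t k i j)"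
    by (simp only: t sum.distrib)
  also have "?S (\<lambda>i j k. ?t j k i) = ?S ?t"
    using s12[of "\<lambda>i j k. ?t i k j"] s23[of ?t] by simp
  also have "?S (\<lambda>i j k. ?t k i j) = ?S ?t"
    using s23[of "\<lambda>i j k. ?t j i k"] s12[of ?t] by simp
  also have "?S ?t + ?S ?t + ?S ?t = 3 *\<^sub>R ?S ?t"
    by (simp add: vec_eq_iff)
  finally have "2 *\<^sub>R (\<Sum>(i, j, k)\<in>increasing_triples I. n i j k *\<^sub>R ?W i j k) = ?S ?t"
    by (simp add: vec_eq_iff)
  also have "\<dots> = ?S (\<lambda>i k j. ?t i j k)"
    by (rule s23[symmetric])
  finally show ?thesis
    by (simp add: scaleR_sum_right mult.commute)
qed

section \<open>The second compound of the identity\<close>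

text \<open>The hypothesis \<open>gv\<close> says that the matrices \<open>g i (v i)^T\<close> sum
  to the identity, and \<open>g0\<close> makes this insensitive to the shift by \<open>w\<close>.
  Summing over \<open>j\<close> and then applying Lagrange's formula leaves trace minus identity,
  that is 3 - 1 = 2.\<close>

lemma sum_cross_triple:
  fixes v g :: "'i \<Rightarrow> real^3"
  assumes g0: "(\<Sum>i\<in>I. g i) = 0" and gv: "\<And>a. (\<Sum>i\<in>I. (v i \<bullet> a) *\<^sub>R g i) = a"
  shows "(\<Sum>k\<in>I. \<Sum>j\<in>I. (y \<bullet> ((v j - w) \<times> (v k - w))) *\<^sub>R (g j \<times> g k)) = 2 *\<^sub>R y"
proof -
  define u where "u i = v i - w" for i
  have gu: "(\<Sum>i\<in>I. (u i \<bullet> a) *\<^sub>R g i) = a" for a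
    by (simp add: u_def inner_diff_left scaleR_diff_left sum_subtractf gv g0
        flip: scaleR_sum_right)
  \<comment> \<open>The identity in entries, which gives both the trace and the version with
    \<open>u\<close> and \<open>g\<close> exchanged.\<close>
  have ug: "(\<Sum>i\<in>I. u i $ p * g i $ q) = (if p = q then 1 else 0)" for p q
    using arg_cong[OF gu[of "axis p 1"], of "\<lambda>z. z $ q"]
    by (simp add: inner_axis) (auto simp: axis_def)
  have "(\<Sum>j\<in>I. (y \<bullet> (u j \<times> u k)) *\<^sub>R (g j \<times> g k)) = (u k \<times> y) \<times> g k" for k
  proof -
    have "y \<bullet> (u j \<times> u k) = u j \<bullet> (u k \<times> y)" for j
      by (metis cross_triple inner_commute)
    then have "(\<Sum>j\<in>I. (y \<bullet> (u j \<times> u k)) *\<^sub>R (g j \<times> g k)) =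
        (\<Sum>j\<in>I. ((u j \<bullet> (u k \<times> y)) *\<^sub>R g j) \<times> g k)"
      by (simp only: cross_mult_left)
    also have "\<dots> = (\<Sum>j\<in>I. (u j \<bullet> (u k \<times> y)) *\<^sub>R g j) \<times> g k"
      by (rule linear_sum[symmetric]) (use bilinear_cross in \<open>simp add: bilinear_def\<close>)
    finally show ?thesis by (simp only: gu)
  qed
  then have "(\<Sum>k\<in>I. \<Sum>j\<in>I. (y \<bullet> (u j \<times> u k)) *\<^sub>R (g j \<times> g k)) = (\<Sum>k\<in>I. (u k \<times> y) \<times> g k)"
    by simp
  also have "\<dots> = (\<Sum>k\<in>I. (u k \<bullet> g k) *\<^sub>R y - (g k \<bullet> y) *\<^sub>R u k)"
    by (rule sum.cong[OF refl], subst cross_skew) (simp add: Lagrange inner_commute)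
  also have "\<dots> = 2 *\<^sub>R y"
  proof -
    have trace: "(\<Sum>k\<in>I. (u k \<bullet> g k)) = 3"
      by (simp add: inner_vec_def sum_3 sum.distrib ug)
    have "(\<Sum>k\<in>I. (g k \<bullet> y) *\<^sub>R u k) $ p = y $ p" for p
    proof -
      have "(\<Sum>k\<in>I. (g k \<bullet> y) *\<^sub>R u k) $ p = (\<Sum>q\<in>UNIV. y $ q * (\<Sum>k\<in>I. u k $ p * g k $ q))"
        by (simp add: inner_vec_def sum_3 sum.distrib sum_distrib_left algebra_simps)
      also have "\<dots> = y $ p"
        using exhaust_3[of p] by (auto simp: ug sum_3)
      finally show ?thesis .
    qed
    then have "(\<Sum>k\<in>I. (g k \<bullet> y) *\<^sub>R u k) = y"
      unfolding vec_eq_iff by blast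
    then have "(\<Sum>k\<in>I. (u k \<bullet> g k) *\<^sub>R y - (g k \<bullet> y) *\<^sub>R u k) = 3 *\<^sub>R y - y"
      by (simp only: sum_subtractf scaleR_sum_left[symmetric] trace)
    then show ?thesis
      by (simp add: vec_eq_iff)
  qed
  finally show ?thesis
    by (simp add: u_def)
qed

section \<open>Gradients relative to a convex body\<close>

text \<open>Also at a boundary point, segments inside \<open>m\<close> determine the derivative on
  all \<open>p - x\<close> with \<open>p\<close> in \<open>m\<close>. Since \<open>m\<close>
  contains a ball, differences of such vectors reach every direction up to scaling.\<close>

lemma has_derivative_unique_convex:
  fixes f :: "'a::euclidean_space \<Rightarrow> 'b::real_normed_vector"
  assumes "convex m" "interior m \<noteq> {}" "x \<in> m"
    and D1: "(f has_derivative f1) (at x within m)" and D2: "(f has_derivative f2) (at x within m)"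
  shows "f1 = f2"
proof -
  interpret f1: bounded_linear f1 using D1 by (rule has_derivative_bounded_linear)
  interpret f2: bounded_linear f2 using D2 by (rule has_derivative_bounded_linear)
  have eq: "f1 (p - x) = f2 (p - x)" if p: "p \<in> m" for p
  proof -
    let ?c = "\<lambda>t::real. x + t *\<^sub>R (p - x)"
    have sub: "?c ` {0..1} \<subseteq> m"
      using convexD_alt[OF \<open>convex m\<close> \<open>x \<in> m\<close> p] by (auto simp: algebra_simps)
    have c: "(?c has_vector_derivative p - x) (at 0 within {0..1})"
      by (auto intro!: derivative_eq_intros)
    have D: "((f \<circ> ?c) has_vector_derivative D (p - x)) (at 0 within {0..1})"
      if "(f has_derivative D) (at x within m)" for D
      using vector_derivative_diff_chain_within[OF c, of f D]
        has_derivative_subset[OF that sub] by simp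
    show ?thesis
      by (rule vector_derivative_unique_within_closed_interval[of 0 1 0])
        (use D[OF D1] D[OF D2] in simp_all)
  qed
  obtain p e where e: "e > 0" "ball p e \<subseteq> m"
    using \<open>interior m \<noteq> {}\<close> by (meson ex_in_conv mem_interior)
  have "f1 h = f2 h" for h
  proof -
    \<comment> \<open>Small enough to keep \<open>p + t h\<close> in the ball; the summand 1 covers
      \<open>h = 0\<close>.\<close>
    define t where "t = e / (1 + norm h)"
    have t: "t > 0" using e by (simp add: t_def add_pos_nonneg)
    have "t * norm h < e"
      using e by (simp add: t_def pos_divide_less_eq add_pos_nonneg distrib_left)
    then have "p + t *\<^sub>R h \<in> m" "p \<in> m"
      using e t by (auto simp: dist_norm intro!: subsetD[OF e(2)])
    from this[THEN eq] have "f1 (t *\<^sub>R h + (p - x)) = f2 (t *\<^sub>R h + (p - x))"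
      and "f1 (p - x) = f2 (p - x)"
      by (simp_all add: algebra_simps)
    then have "f1 (t *\<^sub>R h) = f2 (t *\<^sub>R h)"
      by (simp add: f1.add f2.add)
    then show ?thesis using t by (simp add: f1.scaleR f2.scaleR)
  qed
  then show ?thesis by blast
qed

text \<open>Justifies the definite description in \<open>grad\<close>: the adjoint applied to 1
  represents the derivative as an inner product, and uniqueness of derivatives makes the
  representing vector unique.\<close>

lemma has_derivative_grad:
  assumes "convex m" "interior m \<noteq> {}" "x \<in> m" and diff: "f differentiable (at x within m)"
  shows "(f has_derivative (\<lambda>h. grad m f x \<bullet> h)) (at x within m)"
proof -
  obtain f' where f': "(f has_derivative f') (at x within m)"
    using diff by (auto simp: differentiable_def)
  then have lin: "linear f'"
    using has_derivative_bounded_linear bounded_linear.linear by blast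
  have "f' = (\<lambda>h. adjoint f' 1 \<bullet> h)"
    using adjoint_works[OF lin, of _ 1] by (auto simp: inner_commute)
  then have ex: "(f has_derivative (\<lambda>h. adjoint f' 1 \<bullet> h)) (at x within m)"
    using f' by metis
  show ?thesis
    unfolding grad_def
  proof (rule theI[of "\<lambda>g. (f has_derivative (\<lambda>h. g \<bullet> h)) (at x within m)", OF ex])
    fix g assume "(f has_derivative (\<lambda>h. g \<bullet> h)) (at x within m)"
    then have "(\<lambda>h. g \<bullet> h) = (\<lambda>h. adjoint f' 1 \<bullet> h)"
      by (rule has_derivative_unique_convex[OF assms(1-3) _ ex])
    then have "\<forall>h. g \<bullet> h = adjoint f' 1 \<bullet> h"
      by (rule fun_cong[THEN allI])
    then show "g = adjoint f' 1"
      by (rule vector_eq_rdot[THEN iffD1])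
  qed
qed

text \<open>Both sides of the reproduction formula for \<open>c + y \<bullet> a\<close> are
  differentiated at \<open>x\<close>. The choices \<open>c = 1\<close>, \<open>a = 0\<close> and
  \<open>c = 0\<close> will supply the two hypotheses of \<open>sum_cross_triple\<close>.\<close>

lemma sum_grad_generalized_barycentric:
  assumes "convex m" "interior m \<noteq> {}"
    and gbc: "generalized_barycentric_coordinates m I v lam" and x: "x \<in> diff_points m I lam"
  shows "(\<Sum>i\<in>I. (c + v i \<bullet> a) *\<^sub>R grad m (lam i) x) = a"
proof -
  have xm: "x \<in> m" using x by (simp add: diff_points_def)
  have lam: "(lam i has_derivative (\<lambda>h. grad m (lam i) x \<bullet> h)) (at x within m)" if "i \<in> I" for i
    using has_derivative_grad[OF assms(1,2) xm] x that by (simp add: diff_points_def)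
  have "degree_le_1 (\<lambda>y. c + y \<bullet> a)"
    unfolding degree_le_1_def by (metis inner_commute)
  then have "c + y \<bullet> a = (\<Sum>i\<in>I. (c + v i \<bullet> a) * lam i y)" if "y \<in> m" for y
    using gbc that unfolding generalized_barycentric_coordinates_def by blast
  moreover have "((\<lambda>y. \<Sum>i\<in>I. (c + v i \<bullet> a) * lam i y) has_derivative
      (\<lambda>h. \<Sum>i\<in>I. (c + v i \<bullet> a) * (grad m (lam i) x \<bullet> h))) (at x within m)"
    by (intro has_derivative_sum has_derivative_mult_right lam)
  ultimately have "((\<lambda>y. c + y \<bullet> a) has_derivative
      (\<lambda>h. \<Sum>i\<in>I. (c + v i \<bullet> a) * (grad m (lam i) x \<bullet> h))) (at x within m)"
    by (rule has_derivative_transform[OF xm])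
  moreover have "((\<lambda>y. c + y \<bullet> a) has_derivative (\<lambda>h. h \<bullet> a)) (at x within m)"
    by (auto intro!: derivative_eq_intros)
  ultimately have "(\<lambda>h. \<Sum>i\<in>I. (c + v i \<bullet> a) * (grad m (lam i) x \<bullet> h)) = (\<lambda>h. h \<bullet> a)"
    by (rule has_derivative_unique_convex[OF assms(1,2) xm])
  from fun_cong[OF this]
  have "(\<Sum>i\<in>I. (c + v i \<bullet> a) *\<^sub>R grad m (lam i) x) \<bullet> h = a \<bullet> h" for h
    by (simp add: inner_sum_left inner_commute[of a h])
  then show ?thesis
    by (rule vector_eq_rdot[THEN iffD1, OF allI])
qed

section \<open>The two identities and the span inclusion\<close>

lemma outer_mult_vector: "outer a b *v y = (y \<bullet> b) *\<^sub>R a"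
  by (simp add: vec_eq_iff matrix_vector_mult_def outer_nth inner_vec_def sum_distrib_left mult_ac)

theorem theorem4p8:
  fixes m :: "(real^3) set"
    and I :: "'i::linorder set"
    and v :: "'i \<Rightarrow> real^3"
    and lam :: "'i \<Rightarrow> real^3 \<Rightarrow> real"
  assumes "polytope m" and "interior m \<noteq> {}"
    and "finite I" and "bij_betw v I {p. p extreme_point_of m}"
    and "generalized_barycentric_coordinates m I v lam"
  shows "(\<forall>x \<in> diff_points m I lam.
            (\<Sum>(i, j, k) \<in> increasing_triples I.
               outer (whitney m lam i j k x) ((v j - v i) \<times> (v k - v i))) = mat 1) \<and>
         (\<forall>x \<in> diff_points m I lam.
            (\<Sum>(i, j, k) \<in> increasing_triples I.
               (v i \<bullet> (v j \<times> v k)) *\<^sub>R whitney m lam i j k x) = x) \<and>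
         on_points (diff_points m I lam) ` P1minus_fields
           \<subseteq> fields.span {on_points (diff_points m I lam) (whitney m lam i j k) | i j k.
                i \<in> I \<and> j \<in> I \<and> k \<in> I}"
proof -
  let ?D = "diff_points m I lam"
  let ?T = "increasing_triples I"
  let ?W = "whitney m lam"
  let ?N = "\<lambda>i j k. (v j - v i) \<times> (v k - v i)"
  have conv: "convex m" using \<open>polytope m\<close> by (rule polytope_imp_convex)
  note grad = sum_grad_generalized_barycentric[OF conv assms(2,5)]
  have gv: "(\<Sum>i\<in>I. (v i \<bullet> a) *\<^sub>R grad m (lam i) x) = a" if "x \<in> ?D" for a x
    using grad[OF that, of 0 a] by simp
  have g0: "(\<Sum>i\<in>I. grad m (lam i) x) = 0" if "x \<in> ?D" for x
    using grad[OF that, of 1 0] by simp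
  note cross = sum_cross_triple[OF g0 gv]
  have repr: "L x = (\<Sum>i\<in>I. L (v i) * lam i x)" if "x \<in> ?D" "degree_le_1 L" for x L
    using assms(5) that unfolding generalized_barycentric_coordinates_def diff_points_def by blast
  have part: "(\<Sum>i\<in>I. lam i x) = 1" if "x \<in> ?D" for x
    using repr[OF that, of "\<lambda>_. 1"] by (force simp: degree_le_1_def intro: exI[of _ 0])
  have pos: "(\<Sum>i\<in>I. lam i x *\<^sub>R v i) = x" if "x \<in> ?D" for x
  proof -
    have "degree_le_1 (\<lambda>y. y $ p)" for p
      unfolding degree_le_1_def
      by (rule exI[of _ "axis p 1"], rule exI[of _ 0]) (simp add: inner_axis')
    from repr[OF that this] show ?thesis
      by (simp add: vec_eq_iff mult.commute)
  qed
  \<comment> \<open>The matrix identity tested on a vector \<open>y\<close>: the compound identity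
    with \<open>w = v i\<close>, averaged with weights of sum 1.\<close>
  have const: "(\<Sum>(i, j, k)\<in>?T. (y \<bullet> ?N i j k) *\<^sub>R ?W i j k x) = y" if x: "x \<in> ?D" for x y
  proof -
    have "2 *\<^sub>R (\<Sum>(i, j, k)\<in>?T. (y \<bullet> ?N i j k) *\<^sub>R ?W i j k x) =
        (\<Sum>i\<in>I. lam i x *\<^sub>R (\<Sum>k\<in>I. \<Sum>j\<in>I. (y \<bullet> ?N i j k) *\<^sub>R
          (grad m (lam j) x \<times> grad m (lam k) x)))"
      by (rule sum_increasing_triples_whitney[OF \<open>finite I\<close>])
        (simp_all add: inner_vec_def sum_3 cross3_def algebra_simps)
    also have "\<dots> = (\<Sum>i\<in>I. lam i x *\<^sub>R 2 *\<^sub>R y)"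
      by (simp only: cross[OF x x])
    finally show ?thesis
      by (simp add: part[OF x] flip: scaleR_sum_left sum_distrib_right)
  qed
  \<comment> \<open>Here \<open>w = 0\<close> and the test vector is \<open>v i\<close> itself, so
    the weighted average is the position \<open>x\<close>.\<close>
  have ident: "(\<Sum>(i, j, k)\<in>?T. (v i \<bullet> (v j \<times> v k)) *\<^sub>R ?W i j k x) = x" if x: "x \<in> ?D" for x
  proof -
    have "2 *\<^sub>R (\<Sum>(i, j, k)\<in>?T. (v i \<bullet> (v j \<times> v k)) *\<^sub>R ?W i j k x) =
        (\<Sum>i\<in>I. lam i x *\<^sub>R (\<Sum>k\<in>I. \<Sum>j\<in>I. (v i \<bullet> (v j \<times> v k)) *\<^sub>R
          (grad m (lam j) x \<times> grad m (lam k) x)))"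
      by (rule sum_increasing_triples_whitney[OF \<open>finite I\<close>])
        (simp_all add: inner_vec_def sum_3 cross3_def algebra_simps)
    also have "\<dots> = (\<Sum>i\<in>I. lam i x *\<^sub>R 2 *\<^sub>R v i)"
      using cross[OF x x, of _ 0] by simp
    also have "\<dots> = 2 *\<^sub>R (\<Sum>i\<in>I. lam i x *\<^sub>R v i)"
      by (simp add: scaleR_sum_right mult.commute)
    finally show ?thesis
      by (simp add: pos[OF x])
  qed
  have "(\<Sum>(i, j, k)\<in>?T. outer (?W i j k x) (?N i j k)) = mat 1" if x: "x \<in> ?D" for x
  proof -
    have "(\<Sum>t\<in>A. M t) *v y = (\<Sum>t\<in>A. M t *v y)"
      for M :: "'i \<times> 'i \<times> 'i \<Rightarrow> real^3^3" and A y
      by (induction A rule: infinite_finite_induct) (simp_all add: matrix_vector_mult_add_rdistrib)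
    then have "(\<Sum>(i, j, k)\<in>?T. outer (?W i j k x) (?N i j k)) *v y = mat 1 *v y" for y
      using const[OF x, of y] by (simp add: case_prod_unfold outer_mult_vector)
    then show ?thesis
      by (simp add: matrix_eq)
  qed
  moreover have "on_points ?D F \<in> fields.span {on_points ?D (?W i j k) | i j k.
      i \<in> I \<and> j \<in> I \<and> k \<in> I}" (is "_ \<in> fields.span ?G") if "F \<in> P1minus_fields" for F
  proof -
    obtain c s where F: "F = (\<lambda>x. c + s *\<^sub>R x)"
      using \<open>F \<in> P1minus_fields\<close> unfolding P1minus_fields_iff by blast
    \<comment> \<open>The coefficients add the expansion of \<open>c\<close> from
      \<open>const\<close> to \<open>s\<close> times that of \<open>x\<close> from
      \<open>ident\<close>. They do not depend on \<open>x\<close>, so this is a real linear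
      combination of fields.\<close>
    let ?r = "\<lambda>(i, j, k). c \<bullet> ?N i j k + s * (v i \<bullet> (v j \<times> v k))"
    let ?V = "\<lambda>(i, j, k). on_points ?D (?W i j k)"
    have "on_points ?D F = (\<Sum>t\<in>?T. scale_field (?r t) (?V t))"
    proof
      fix x
      have app: "(\<Sum>t\<in>A. f t) x = (\<Sum>t\<in>A. f t x)"
        for f :: "'i \<times> 'i \<times> 'i \<Rightarrow> real^3 \<Rightarrow> real^3" and A
        by (induction A rule: infinite_finite_induct) simp_all
      show "on_points ?D F x = (\<Sum>t\<in>?T. scale_field (?r t) (?V t)) x"
      proof (cases "x \<in> ?D")
        case True
        have "F x = (\<Sum>(i, j, k)\<in>?T. (c \<bullet> ?N i j k) *\<^sub>R ?W i j k x) +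
            s *\<^sub>R (\<Sum>(i, j, k)\<in>?T. (v i \<bullet> (v j \<times> v k)) *\<^sub>R ?W i j k x)"
          by (simp only: F const[OF True] ident[OF True])
        then show ?thesis
          using True by (simp add: app on_points_def scale_field_def case_prod_unfold
              scaleR_sum_right scaleR_add_left sum.distrib)
      next
        \<comment> \<open>Off the differentiability points every extension by zero vanishes.\<close>
        case False
        then show ?thesis
          by (simp add: app on_points_def scale_field_def case_prod_unfold)
      qed
    qed
    also have "\<dots> \<in> fields.span ?G"
      by (intro fields.span_sum fields.span_scale fields.span_base)
        (auto simp: increasing_triples_def)
    finally show ?thesis .
  qed
  ultimately show ?thesis
    using ident by blast
qed

end
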